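(* Let $n\ge 1$, let $A:[0,\infty)\to\mathbb{R}^{n\times n}$ be a continuous matrix function, and let $w:\mathbb{R}^n\times[0,\infty)\to\mathbb{R}^n$ be continuous in $(x,t)$. Let $\|\cdot\|$ be some vector norm on $\mathbb{R}^n$, and let $\mu[\cdot]$ be the associated logarithmic norm. Suppose that 1) $\lim_{t\to\infty}\int_0^t\mu[A(s)]\,ds=-\infty$. Then $x=0\in\mathbb{R}^n$ is a globally asymptotically stable equilibrium point of the unperturbed system $\dot x=A(t)x$, $t\ge 0$. Moreover, if in addition, for the same norm, 2) $\mu[A(t)]<0$ for all sufficiently large $t$, and 3) there is a function $\tilde w:[0,\infty)\to\mathbb{R}^n$ such that $\|w(x,t)\|\le\|\tilde w(t)\|$ for all $x\in\mathbb{R}^n$ and all $t\ge 0$, and $$\lim_{t\to\infty}\frac{\|\tilde w(t)\|}{\mu[A(t)]}=0,$$ then all solutions $x(t)$, $t\ge 0$, of the perturbed system $\dot x=A(t)x+w(x,t)$ converge to $0$ as $t\to\infty$.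
   Context: For a vector norm $\|\cdot\|$ on $\mathbb{R}^n$, the matrix norm is the induced operator norm $\|M\|=\max_{\|x\|=1}\|Mx\|$ for $M\in\mathbb{R}^{n\times n}$. The logarithmic norm of $M$ associated with $\|\cdot\|$ is $$\mu[M]=\lim_{h\to0^+}\frac{\|I_n+hM\|-1}{h},$$ where $I_n$ is the identity matrix on $\mathbb{R}^n$. When $A(\cdot)$ is continuous, $t\mapsto\mu[A(t)]$ is continuous. Global asymptotic stability of $x=0$ is meant in the usual (not necessarily uniform) Lyapunov sense: $x=0$ is stable and every solution converges to $0$ as $t\to\infty$. The point $x=0$ need not be a solution of the perturbed system. *)

theory Defs
  imports "HOL-Analysis.Analysis"
begin

definition vector_norm :: "('a::real_vector \<Rightarrow> real) \<Rightarrow> bool" where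
  "vector_norm N \<longleftrightarrow>
     (\<forall>x. 0 \<le> N x) \<and> (\<forall>x. N x = 0 \<longleftrightarrow> x = 0) \<and>
     (\<forall>c x. N (c *\<^sub>R x) = \<bar>c\<bar> * N x) \<and> (\<forall>x y. N (x + y) \<le> N x + N y)"

(* For a vector norm N, the supremum is a maximum: the unit sphere of N is
   nonempty and compact, and N is continuous. *)
definition induced_matrix_norm ::
  "(real ^ 'n \<Rightarrow> real) \<Rightarrow> real ^ 'n ^ 'n \<Rightarrow> real" where
  "induced_matrix_norm N M = (SUP x\<in>{x. N x = 1}. N (M *v x))"

(* For a vector norm N, the limit exists: by convexity of the matrix norm the
   difference quotient is nondecreasing in h > 0 and bounded below. *)
definition logarithmic_norm ::
  "(real ^ 'n \<Rightarrow> real) \<Rightarrow> real ^ 'n ^ 'n \<Rightarrow> real" where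
  "logarithmic_norm N M =
     Lim (at_right 0) (\<lambda>h. (induced_matrix_norm N (mat 1 + h *\<^sub>R M) - 1) / h)"

(* x solves x' = f(x,t) on J, with one-sided derivatives at endpoints of J. *)
definition solution_on ::
  "('a::real_normed_vector \<Rightarrow> real \<Rightarrow> 'a) \<Rightarrow> real set \<Rightarrow> (real \<Rightarrow> 'a) \<Rightarrow> bool" where
  "solution_on f J x \<longleftrightarrow> (\<forall>t\<in>J. (x has_vector_derivative f (x t) t) (at t within J))"

definition equilibrium_zero :: "('a::real_normed_vector \<Rightarrow> real \<Rightarrow> 'a) \<Rightarrow> bool" where
  "equilibrium_zero f \<longleftrightarrow> (\<forall>t\<ge>0. f 0 t = 0)"

(* Not necessarily uniform: d may depend on the initial time t0. The bound is
   required for as long as the solution exists, hence the intervals {t0..T}. *)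
definition lyapunov_stable_zero :: "('a::real_normed_vector \<Rightarrow> real \<Rightarrow> 'a) \<Rightarrow> bool" where
  "lyapunov_stable_zero f \<longleftrightarrow>
     (\<forall>t0\<ge>0. \<forall>e>0. \<exists>d>0. \<forall>T\<ge>t0. \<forall>x.
        solution_on f {t0..T} x \<longrightarrow> norm (x t0) < d \<longrightarrow> (\<forall>t\<in>{t0..T}. norm (x t) < e))"

definition globally_asymptotically_stable_zero ::
  "('a::real_normed_vector \<Rightarrow> real \<Rightarrow> 'a) \<Rightarrow> bool" where
  "globally_asymptotically_stable_zero f \<longleftrightarrow>
     equilibrium_zero f \<and> lyapunov_stable_zero f \<and>
     (\<forall>t0\<ge>0. \<forall>x. solution_on f {t0..} x \<longrightarrow> (x \<longlongrightarrow> 0) at_top)"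

end

theory Submission
  imports Defs
begin

text \<open>
  Along a solution, \<open>N (x (t + h)) \<le> \<parallel>1 + h A(t)\<parallel> N (x t) + h N (w (x t) t) + o(h)\<close>, so
  \<open>u = N \<circ> x\<close> has upper right Dini derivative at most \<open>\<mu>[A(t)] u + N (w (x t) t)\<close>. Where
  \<open>N (w (x t) t) \<le> - \<eta> \<mu>[A(t)]\<close> this bound is \<open>\<mu>[A(t)] (u - \<eta>)\<close>, hence
  \<open>u(t) - \<eta> \<le> exp (\<integral>\<^sub>s\<^sup>t \<mu>[A]) (u(s) - \<eta>)\<close>. The unperturbed system is the case \<open>\<eta> = 0\<close>; in the
  perturbed one the estimate holds for every \<open>\<eta> > 0\<close> from some time on.
\<close>

section \<open>Norms on Euclidean spaces\<close>

text \<open>Expanding \<open>x\<close> in \<open>Basis\<close> and bounding each coordinate by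
  \<open>norm x\<close> gives the sum of \<open>p\<close> over \<open>Basis\<close> as a constant.
  Definiteness is left out so that the same bound serves both the vector norm and
  \<open>induced_matrix_norm\<close>.\<close>

lemma seminorm_le_norm:
  fixes p :: "'a::euclidean_space \<Rightarrow> real"
  assumes scale: "\<And>c x. p (c *\<^sub>R x) = \<bar>c\<bar> * p x"
    and add: "\<And>x y. p (x + y) \<le> p x + p y"
  obtains C where "C > 0" "\<And>x. p x \<le> C * norm x"
proof -
  have p0: "p 0 = 0"
    using scale[of 0 0] by simp
  have sum: "p (sum f S) \<le> (\<Sum>i\<in>S. p (f i))" if "finite S" for S and f :: "'a \<Rightarrow> 'a"
    using that by (induction S) (auto simp: p0 intro: order_trans[OF add])
  have pos: "p x \<ge> 0" for x
    using add[of x "- x"] scale[of "-1" x] p0 by simp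
  \<comment> \<open>The summand 1 keeps \<open>C\<close> positive even if \<open>p\<close> vanishes
    on \<open>Basis\<close>.\<close>
  define C where "C = (\<Sum>b\<in>Basis. p b) + 1"
  have "p x \<le> C * norm x" for x
  proof -
    have "p x \<le> (\<Sum>b\<in>Basis. p ((x \<bullet> b) *\<^sub>R b))"
      using sum[of Basis "\<lambda>b. (x \<bullet> b) *\<^sub>R b"] by (simp add: euclidean_representation)
    also have "\<dots> \<le> (\<Sum>b\<in>Basis. p b * norm x)"
      by (intro sum_mono) (auto simp: scale mult.commute[of "p _"] intro!: mult_right_mono Basis_le_norm pos)
    also have "\<dots> \<le> C * norm x"
      by (simp add: C_def sum_distrib_right[symmetric] distrib_right)
    finally show ?thesis .
  qed
  moreover have "C > 0"
    unfolding C_def by (intro add_nonneg_pos sum_nonneg pos) auto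
  ultimately show ?thesis
    using that by blast
qed

context
  fixes N :: "'a::euclidean_space \<Rightarrow> real"
  assumes N: "vector_norm N"
begin

lemma vector_norm_nonneg: "0 \<le> N x"
  and vector_norm_eq_0_iff: "N x = 0 \<longleftrightarrow> x = 0"
  and vector_norm_scaleR: "N (c *\<^sub>R x) = \<bar>c\<bar> * N x"
  and vector_norm_triangle: "N (x + y) \<le> N x + N y"
  using N by (auto simp: vector_norm_def)

lemma vector_norm_minus: "N (- x) = N x"
  using vector_norm_scaleR[of "-1" x] by simp

lemma vector_norm_le_norm:
  obtains C where "C > 0" "\<And>x. N x \<le> C * norm x"
  using seminorm_le_norm[of N] vector_norm_scaleR vector_norm_triangle by metis

lemma vector_norm_diff_le: "\<bar>N x - N y\<bar> \<le> N (x - y)"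
  using vector_norm_triangle[of "x - y" y] vector_norm_triangle[of "y - x" x]
    vector_norm_minus[of "x - y"] by simp

lemma continuous_on_vector_norm: "continuous_on S N"
proof -
  obtain C where C: "C > 0" "\<And>x. N x \<le> C * norm x"
    using vector_norm_le_norm by blast
  have "C-lipschitz_on S N"
    using C vector_norm_diff_le
    by (auto simp: lipschitz_on_def dist_norm intro: order_trans)
  then show ?thesis
    by (rule lipschitz_on_continuous_on)
qed

text \<open>By compactness \<open>N\<close> attains its minimum on the Euclidean unit sphere.
  Definiteness makes this minimum positive, and homogeneity carries the bound to all
  \<open>x\<close>.\<close>

lemma norm_le_vector_norm:
  obtains c where "c > 0" "\<And>x. c * norm x \<le> N x"
proof -
  obtain z where z: "z \<in> sphere 0 1" "\<And>y. y \<in> sphere 0 1 \<Longrightarrow> N z \<le> N y"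
    using continuous_attains_inf[of "sphere (0::'a) 1" N] continuous_on_vector_norm by auto
  have "N z * norm x \<le> N x" for x
  proof (cases "x = 0")
    case False
    have "N z \<le> N (inverse (norm x) *\<^sub>R x)"
      using False by (intro z) simp
    then show ?thesis
      using False by (simp add: vector_norm_scaleR field_simps)
  qed (simp add: vector_norm_nonneg)
  moreover have "N z > 0"
    using z(1) vector_norm_eq_0_iff[of z] vector_norm_nonneg[of z] by fastforce
  ultimately show ?thesis
    using that by blast
qed

text \<open>Ensures that the supremum defining \<open>induced_matrix_norm\<close> is over a nonempty
  set.\<close>

lemma vector_norm_unit_exists: "\<exists>x. N x = 1"
proof -
  obtain b :: 'a where "b \<in> Basis"
    using nonempty_Basis by blast
  then have "N b > 0"
    using vector_norm_eq_0_iff[of b] vector_norm_nonneg[of b] nonzero_Basis by fastforce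
  then have "N (inverse (N b) *\<^sub>R b) = 1"
    by (simp add: vector_norm_scaleR)
  then show ?thesis ..
qed

end

section \<open>The logarithmic norm\<close>

context
  fixes N :: "real ^ 'n \<Rightarrow> real"
  assumes N: "vector_norm N"
begin

text \<open>The work lies in showing the supremum to be over a bounded set, via the Euclidean
  operator norm and the equivalence of \<open>N\<close> with \<open>norm\<close>. Then
  \<open>x\<close> is rescaled to an \<open>N\<close>-unit vector.\<close>

lemma induced_matrix_norm_bound: "N (M *v x) \<le> induced_matrix_norm N M * N x"
proof (cases "x = 0")
  case False
  obtain C where C: "C > 0" "\<And>x. N x \<le> C * norm x"
    using vector_norm_le_norm[OF N] by blast
  obtain c where c: "c > 0" "\<And>x. c * norm x \<le> N x"
    using norm_le_vector_norm[OF N] by blast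
  have "N (M *v y) \<le> C * (onorm ((*v) M) * (1 / c))" if "N y = 1" for y
  proof -
    have "norm y \<le> 1 / c"
      using c(2)[of y] c(1) that by (simp add: field_simps)
    then have "norm (M *v y) \<le> onorm ((*v) M) * (1 / c)"
      by (intro order_trans[OF onorm[of "(*v) M"]] mult_left_mono onorm_pos_le) auto
    then show ?thesis
      using C by (meson mult_le_cancel_left_pos order_trans)
  qed
  then have bdd: "bdd_above ((\<lambda>x. N (M *v x)) ` {x. N x = 1})"
    by (auto intro!: bdd_aboveI2)
  have pos: "N x > 0"
    using False vector_norm_eq_0_iff[OF N] vector_norm_nonneg[OF N] by (metis less_eq_real_def)
  have "N (M *v (inverse (N x) *\<^sub>R x)) \<le> induced_matrix_norm N M"
    unfolding induced_matrix_norm_def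
    using pos by (intro cSUP_upper bdd) (simp add: vector_norm_scaleR[OF N])
  then show ?thesis
    using pos by (simp add: matrix_vector_mult_scaleR vector_norm_scaleR[OF N] field_simps)
qed (use vector_norm_eq_0_iff[OF N, of 0] in simp)

text \<open>Replaces the supremum by a pointwise inequality, from which the norm axioms for matrices
  follow directly.\<close>

lemma induced_matrix_norm_le_iff:
  "induced_matrix_norm N M \<le> K \<longleftrightarrow> (\<forall>x. N (M *v x) \<le> K * N x)"
proof
  assume "induced_matrix_norm N M \<le> K"
  then show "\<forall>x. N (M *v x) \<le> K * N x"
    by (meson induced_matrix_norm_bound mult_right_mono order_trans vector_norm_nonneg[OF N])
next
  assume *: "\<forall>x. N (M *v x) \<le> K * N x"
  show "induced_matrix_norm N M \<le> K"
    unfolding induced_matrix_norm_def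
  proof (rule cSUP_least)
    show "{x. N x = 1} \<noteq> {}"
      using vector_norm_unit_exists[OF N] by blast
    show "N (M *v x) \<le> K" if "x \<in> {x. N x = 1}" for x
      using *[rule_format, of x] that by simp
  qed
qed

lemma induced_matrix_norm_triangle:
  "induced_matrix_norm N (L + M) \<le> induced_matrix_norm N L + induced_matrix_norm N M"
  unfolding induced_matrix_norm_le_iff
proof
  fix x
  show "N ((L + M) *v x) \<le> (induced_matrix_norm N L + induced_matrix_norm N M) * N x"
    using induced_matrix_norm_bound[of L x] induced_matrix_norm_bound[of M x]
      vector_norm_triangle[OF N, of "L *v x" "M *v x"]
    by (simp add: matrix_vector_mult_add_rdistrib distrib_right)
qed

lemma induced_matrix_norm_scaleR:
  "induced_matrix_norm N (c *\<^sub>R M) = \<bar>c\<bar> * induced_matrix_norm N M"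
proof -
  \<comment> \<open>Stated for all scalars and matrices: the converse inequality is the instance
    with \<open>inverse c\<close> and \<open>c *\<^sub>R M\<close>.\<close>
  have le: "induced_matrix_norm N (c *\<^sub>R M) \<le> \<bar>c\<bar> * induced_matrix_norm N M" for c M
    unfolding induced_matrix_norm_le_iff
    by (auto simp: scaleR_matrix_vector_assoc[symmetric] vector_norm_scaleR[OF N] mult.assoc
        intro!: mult_left_mono induced_matrix_norm_bound)
  show ?thesis
  proof (cases "c = 0")
    case True
    then show ?thesis
      using vector_norm_unit_exists[OF N] vector_norm_eq_0_iff[OF N, of 0]
      by (auto simp: induced_matrix_norm_def)
  next
    case False
    then show ?thesis
      using le[of c M] le[of "inverse c" "c *\<^sub>R M"] by (simp add: field_simps)
  qed
qed

lemma induced_matrix_norm_mat_1: "induced_matrix_norm N (mat 1) = 1"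
  using vector_norm_unit_exists[OF N] by (auto simp: induced_matrix_norm_def)

text \<open>The value of \<open>Lim\<close> is meaningful only once convergence is known. The
  difference quotient \<open>q\<close> is monotone and bounded below, so it tends to its infimum
  \<open>L\<close> over positive \<open>h\<close>.\<close>

lemma tendsto_logarithmic_norm:
  "((\<lambda>h. (induced_matrix_norm N (mat 1 + h *\<^sub>R M) - 1) / h) \<longlongrightarrow> logarithmic_norm N M) (at_right 0)"
proof -
  define q where "q h = (induced_matrix_norm N (mat 1 + h *\<^sub>R M) - 1) / h" for h
  have mono: "q h \<le> q k" if "0 < h" "h \<le> k" for h k
  proof -
    \<comment> \<open>Convexity: the left side is the convex combination of \<open>mat 1\<close> and
      \<open>mat 1 + k *\<^sub>R M\<close> with weight \<open>h / k\<close> on the latter.\<close>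
    have "mat 1 + h *\<^sub>R M = (1 - h / k) *\<^sub>R mat 1 + (h / k) *\<^sub>R (mat 1 + k *\<^sub>R M)"
      using that by (simp add: scaleR_add_right scaleR_diff_left)
    then have "induced_matrix_norm N (mat 1 + h *\<^sub>R M)
      \<le> (1 - h / k) + (h / k) * induced_matrix_norm N (mat 1 + k *\<^sub>R M)"
      using induced_matrix_norm_triangle[of "(1 - h / k) *\<^sub>R mat 1" "(h / k) *\<^sub>R (mat 1 + k *\<^sub>R M)"]
        that by (simp add: induced_matrix_norm_scaleR induced_matrix_norm_mat_1)
    then have "induced_matrix_norm N (mat 1 + h *\<^sub>R M) - 1
      \<le> (induced_matrix_norm N (mat 1 + k *\<^sub>R M) - 1) / k * h"
      by (simp add: algebra_simps diff_divide_distrib)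
    then show ?thesis
      using that by (simp add: q_def pos_divide_le_eq)
  qed
  have lower: "q h \<ge> - induced_matrix_norm N M" if "0 < h" for h
    using induced_matrix_norm_triangle[of "mat 1 + h *\<^sub>R M" "(- h) *\<^sub>R M"] that
    by (simp add: induced_matrix_norm_scaleR[of "-h", simplified] induced_matrix_norm_mat_1 q_def
        field_simps)
  define L where "L = (INF h\<in>{0<..}. q h)"
  have bdd: "bdd_below (q ` {0<..})"
    using lower by (auto intro!: bdd_belowI2)
  have "(q \<longlongrightarrow> L) (at_right 0)"
  proof (rule order_tendstoI)
    fix a assume "a < L"
    moreover have "L \<le> q h" if "h > 0" for h
      unfolding L_def using that by (intro cINF_lower bdd) auto
    ultimately show "\<forall>\<^sub>F h in at_right 0. a < q h"
      unfolding eventually_at_right_field by (meson less_le_trans zero_less_one)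
  next
    fix a assume "L < a"
    then obtain k where "k > 0" "q k < a"
      unfolding L_def using bdd by (subst (asm) cINF_less_iff) auto
    then show "\<forall>\<^sub>F h in at_right 0. q h < a"
      unfolding eventually_at_right_field by (meson less_imp_le le_less_trans mono)
  qed
  then show ?thesis
    unfolding logarithmic_norm_def q_def[symmetric] by (metis tendsto_Lim trivial_limit_at_right_real)
qed

text \<open>The bound already holds for the difference quotients at each \<open>h > 0\<close>, by
  the triangle inequality, and survives the limit. It yields the Lipschitz continuity of
  \<mu>.\<close>

lemma logarithmic_norm_diff_le:
  "logarithmic_norm N L - logarithmic_norm N M \<le> induced_matrix_norm N (L - M)"
proof (rule tendsto_upperbound)
  let ?q = "\<lambda>M h. (induced_matrix_norm N (mat 1 + h *\<^sub>R M) - 1) / h"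
  show "((\<lambda>h. ?q L h - ?q M h) \<longlongrightarrow> logarithmic_norm N L - logarithmic_norm N M) (at_right 0)"
    by (intro tendsto_diff tendsto_logarithmic_norm)
  have "?q L h - ?q M h \<le> induced_matrix_norm N (L - M)" if "h > 0" for h
  proof -
    have "mat 1 + h *\<^sub>R L = (mat 1 + h *\<^sub>R M) + h *\<^sub>R (L - M)"
      by (simp add: scaleR_diff_right)
    from arg_cong[OF this, of "induced_matrix_norm N"] have "induced_matrix_norm N (mat 1 + h *\<^sub>R L)
      \<le> induced_matrix_norm N (mat 1 + h *\<^sub>R M) + h * induced_matrix_norm N (L - M)"
      using induced_matrix_norm_triangle[of "mat 1 + h *\<^sub>R M" "h *\<^sub>R (L - M)"] that
      by (simp add: induced_matrix_norm_scaleR)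
    then show ?thesis
      using that by (simp add: field_simps)
  qed
  then show "\<forall>\<^sub>F h in at_right 0. ?q L h - ?q M h \<le> induced_matrix_norm N (L - M)"
    by (intro eventually_mono[OF eventually_at_right_less]) blast
qed simp

lemma continuous_on_logarithmic_norm: "continuous_on S (logarithmic_norm N)"
proof -
  obtain C where C: "C > 0" "\<And>M. induced_matrix_norm N M \<le> C * norm M"
    using seminorm_le_norm[of "induced_matrix_norm N"]
      induced_matrix_norm_scaleR induced_matrix_norm_triangle by metis
  have le: "logarithmic_norm N L - logarithmic_norm N M \<le> C * norm (L - M)" for L M
    using logarithmic_norm_diff_le C(2) order_trans by blast
  then have "\<bar>logarithmic_norm N L - logarithmic_norm N M\<bar> \<le> C * norm (L - M)" for L M
    using le[of L M] le[of M L] by (simp add: abs_le_iff norm_minus_commute)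
  then have "C-lipschitz_on S (logarithmic_norm N)"
    using C(1) by (auto simp: lipschitz_on_def dist_norm)
  then show ?thesis
    by (rule lipschitz_on_continuous_on)
qed

lemma eventually_induced_matrix_norm_le:
  assumes "e > 0"
  shows "\<forall>\<^sub>F h in at_right 0.
    induced_matrix_norm N (mat 1 + h *\<^sub>R M) \<le> 1 + h * (logarithmic_norm N M + e)"
proof -
  have "\<forall>\<^sub>F h in at_right 0.
    (induced_matrix_norm N (mat 1 + h *\<^sub>R M) - 1) / h < logarithmic_norm N M + e"
    using order_tendstoD(2)[OF tendsto_logarithmic_norm] assms by simp
  with eventually_at_right_less[of 0] show ?thesis
    by eventually_elim (simp add: field_simps)
qed

end

section \<open>A comparison principle for Dini derivatives\<close>

text \<open>For fixed \<open>e > 0\<close>, consider the last time \<open>c\<close> at which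
  \<open>y\<close> is not above the line of slope \<open>e\<close> through the point
  \<open>(a, y a)\<close>. If \<open>c < b\<close>, the Dini condition keeps \<open>y\<close> below
  the line slightly beyond \<open>c\<close>, a contradiction. Finally \<open>e\<close> tends to
  0.\<close>

lemma dini_nonpos_imp_le:
  fixes y :: "real \<Rightarrow> real"
  assumes "a \<le> b" and cont: "continuous_on {a..b} y"
    and dini: "\<And>t e. a \<le> t \<Longrightarrow> t < b \<Longrightarrow> e > 0 \<Longrightarrow> \<forall>\<^sub>F s in at_right t. y s \<le> y t + e * (s - t)"
  shows "y b \<le> y a"
proof -
  have "y b \<le> y a + e * (b - a)" if e: "e > 0" for e
  proof (rule ccontr)
    define g where "g t = y t - y a - e * (t - a)" for t
    define S where "S = {t \<in> {a..b}. g t \<le> 0}"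
    assume "\<not> y b \<le> y a + e * (b - a)"
    then have gb: "g b > 0"
      by (simp add: g_def)
    have "continuous_on {a..b} g"
      unfolding g_def[abs_def] by (intro continuous_intros cont)
    then have "closed ({a..b} \<inter> g -` {..0})"
      by (intro continuous_closed_preimage) auto
    then have "compact ({a..b} \<inter> ({a..b} \<inter> g -` {..0}))"
      by (rule compact_Int_closed[OF compact_Icc])
    moreover have "{a..b} \<inter> ({a..b} \<inter> g -` {..0}) = S"
      by (auto simp: S_def)
    ultimately have "compact S"
      by (simp only:)
    moreover have "a \<in> S"
      using \<open>a \<le> b\<close> by (simp add: S_def g_def)
    ultimately obtain c where c: "c \<in> S" "\<forall>t\<in>S. t \<le> c"
      using compact_attains_sup[of S] by blast
    have c_mem: "a \<le> c" "c \<le> b" "g c \<le> 0"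
      using c(1) by (simp_all add: S_def)
    have "c < b"
      using c_mem gb by (cases "c = b") simp_all
    have "\<forall>\<^sub>F s in at_right c. y s \<le> y c + e * (s - c)"
      using c_mem(1) \<open>c < b\<close> e by (intro dini)
    moreover have "\<forall>\<^sub>F s in at_right c. s \<in> {c<..<b}"
      using \<open>c < b\<close> by (rule eventually_at_right_real)
    \<comment> \<open>Points just to the right of \<open>c\<close> would belong to \<open>S\<close>,
      although \<open>c\<close> is its maximum; \<open>at_right c\<close> is a nontrivial filter, so
      this is absurd.\<close>
    ultimately have "\<forall>\<^sub>F s in at_right c. False"
    proof eventually_elim
      case (elim s)
      then have "s \<in> S"
        using c_mem by (simp add: S_def g_def algebra_simps)
      with c(2) elim(2) show False
        by auto
    qed
    then show False
      by simp
  qed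
  then have "\<forall>\<^sub>F e in at_right 0. y b \<le> y a + e * (b - a)"
    by (intro eventually_mono[OF eventually_at_right_less]) blast
  moreover have "((\<lambda>e. y a + e * (b - a)) \<longlongrightarrow> y a + 0 * (b - a)) (at_right 0)"
    by (intro tendsto_intros)
  ultimately show ?thesis
    using tendsto_lowerbound[of "\<lambda>e. y a + e * (b - a)" "y a" "at_right 0" "y b"] by simp
qed

lemma eventually_le_of_derivative_less:
  fixes f :: "real \<Rightarrow> real"
  assumes "(f has_real_derivative D) (at_right t)" "D < D'"
  shows "\<forall>\<^sub>F s in at_right t. f s \<le> f t + D' * (s - t)"
proof -
  have "\<forall>\<^sub>F s in at_right t. (f s - f t) / (s - t) < D'"
    using order_tendstoD(2)[OF assms(1)[unfolded has_field_derivative_iff]] assms(2) by simp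
  with eventually_at_right_less[of t] show ?thesis
    by eventually_elim (simp add: field_simps)
qed

text \<open>With the integrating factor \<open>E\<close>, the product \<open>E t * v t\<close> has
  nonpositive upper right Dini derivative. Negative values of \<open>v\<close> are allowed, since
  the lemma is applied to \<open>N (x t) - \<eta>\<close>.\<close>

lemma dini_gronwall:
  fixes v m :: "real \<Rightarrow> real"
  assumes "a \<le> b" and v: "continuous_on {a..b} v" and m: "continuous_on {a..b} m"
    and dini: "\<And>t e. a \<le> t \<Longrightarrow> t < b \<Longrightarrow> e > 0 \<Longrightarrow>
      \<forall>\<^sub>F s in at_right t. v s \<le> v t + (s - t) * (m t * v t + e)"
  shows "v b \<le> exp (integral {a..b} m) * v a"
proof -
  define E where "E t = exp (- integral {a..t} m)" for t
  have deriv: "(E has_real_derivative - m t * E t) (at t within {a..b})" if "t \<in> {a..b}" for t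
    unfolding E_def
    by (auto intro!: derivative_eq_intros integral_has_real_derivative m that)
  have "E b * v b \<le> E a * v a"
  proof (rule dini_nonpos_imp_le[OF \<open>a \<le> b\<close>])
    show "continuous_on {a..b} (\<lambda>t. E t * v t)"
      using deriv by (intro continuous_intros v DERIV_continuous_on)
  next
    fix t e :: real
    assume t: "a \<le> t" "t < b" and e: "e > 0"
    \<comment> \<open>Multiplication by \<open>E\<close> turns the slack \<open>d\<close> into
      \<open>E t * d = e / 2\<close>, strictly below \<open>e\<close>.\<close>
    define d where "d = e / (2 * E t)"
    have pos: "E s > 0" for s
      by (simp add: E_def)
    have d: "d > 0" "E t * d < e"
      using pos[of t] e by (auto simp: d_def)
    have "(E has_real_derivative - m t * E t) (at_right t)"
      using has_field_derivative_subset[OF deriv[of t], of "{t..b}"] t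
      by (simp add: at_within_Icc_at_right)
    \<comment> \<open>In the product rule at \<open>s = t\<close> the two terms containing
      \<open>m t\<close> cancel, leaving only the slack.\<close>
    then have "((\<lambda>s. E s * (v t + (s - t) * (m t * v t + d))) has_real_derivative E t * d) (at_right t)"
      by (auto intro!: derivative_eq_intros simp: algebra_simps)
    from eventually_le_of_derivative_less[OF this d(2)] dini[OF t d(1)]
    show "\<forall>\<^sub>F s in at_right t. E s * v s \<le> E t * v t + e * (s - t)"
    proof eventually_elim
      case (elim s)
      then have "E s * v s \<le> E s * (v t + (s - t) * (m t * v t + d))"
        using pos[of s] by simp
      with elim show ?case
        by simp
    qed
  qed
  then show ?thesis
    by (simp add: E_def exp_minus field_simps)
qed

section \<open>Estimates along solutions\<close>

lemma solution_on_subset: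
  "solution_on f J x \<Longrightarrow> I \<subseteq> J \<Longrightarrow> solution_on f I x"
  unfolding solution_on_def by (meson has_vector_derivative_within_subset subsetD)

text \<open>To first order, \<open>x s\<close> is \<open>mat 1 + (s - a) *\<^sub>R M\<close> applied
  to \<open>x a\<close>, plus \<open>(s - a) *\<^sub>R z\<close>. Half of \<open>e\<close> pays for
  the remainder, the other half for replacing the matrix norm by its expansion with \<mu>.\<close>

lemma solution_dini:
  fixes N :: "real ^ 'n \<Rightarrow> real"
  assumes N: "vector_norm N" and "a < b" and e: "e > 0"
    and x: "(x has_vector_derivative M *v x a + z) (at a within {a..b})"
  shows "\<forall>\<^sub>F s in at_right a.
    N (x s) \<le> N (x a) + (s - a) * (logarithmic_norm N M * N (x a) + N z + e)"
proof -
  let ?y = "M *v x a + z"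
  obtain C where C: "C > 0" "\<And>x. N x \<le> C * norm x"
    using vector_norm_le_norm[OF N] by blast
  \<comment> \<open>The summand 1 avoids division by zero when \<open>x a = 0\<close>.\<close>
  define d where "d = e / 2 / (N (x a) + 1)"
  have Nx: "N (x a) \<ge> 0"
    by (rule vector_norm_nonneg[OF N])
  have d: "d > 0" "d * N (x a) \<le> e / 2"
    using e Nx by (auto simp: d_def field_simps)
  have "(x has_vector_derivative ?y) (at_right a)"
    using x \<open>a < b\<close> by (simp add: at_within_Icc_at_right)
  then have "((\<lambda>s. norm (x s - x a - (s - a) *\<^sub>R ?y) / norm (s - a)) \<longlongrightarrow> 0) (at_right a)"
    by (simp add: has_vector_derivative_def has_derivative_iff_norm)
  \<comment> \<open>Dividing by \<open>C\<close> turns the Euclidean remainder estimate into one of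
    size \<open>e / 2\<close> measured in \<open>N\<close>.\<close>
  then have "\<forall>\<^sub>F s in at_right a. norm (x s - x a - (s - a) *\<^sub>R ?y) / norm (s - a) < e / 2 / C"
    using C(1) e by (intro order_tendstoD) auto
  moreover have "\<forall>\<^sub>F s in at_right a. induced_matrix_norm N (mat 1 + (s - a) *\<^sub>R M)
      \<le> 1 + (s - a) * (logarithmic_norm N M + d)"
    using eventually_induced_matrix_norm_le[OF N d(1), of M]
    by (simp add: eventually_at_right_to_0[of _ a])
  ultimately show ?thesis
    using eventually_at_right_less[of a]
  proof eventually_elim
    case (elim s)
    let ?h = "s - a"
    let ?r = "x s - x a - ?h *\<^sub>R ?y"
    have eq: "x s = (mat 1 + ?h *\<^sub>R M) *v x a + (?h *\<^sub>R z + ?r)"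
      by (simp add: matrix_vector_mult_add_rdistrib scaleR_matrix_vector_assoc[symmetric]
          scaleR_add_right)
    have "N (x s) \<le> N ((mat 1 + ?h *\<^sub>R M) *v x a) + N (?h *\<^sub>R z + ?r)"
      by (subst eq) (rule vector_norm_triangle[OF N])
    moreover have "N (?h *\<^sub>R z + ?r) \<le> ?h * N z + N ?r"
      using vector_norm_triangle[OF N, of "?h *\<^sub>R z" ?r] vector_norm_scaleR[OF N, of ?h z] elim(3)
      by simp
    moreover have "N ((mat 1 + ?h *\<^sub>R M) *v x a) \<le> (1 + ?h * (logarithmic_norm N M + d)) * N (x a)"
      using elim(2) induced_matrix_norm_le_iff[OF N] by blast
    moreover have "N ?r \<le> ?h * (e / 2)"
    proof -
      have "C * norm ?r \<le> ?h * (e / 2)"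
        using elim(1,3) C(1) by (simp add: field_simps)
      then show ?thesis
        using C(2) order_trans by blast
    qed
    moreover have "?h * (d * N (x a)) \<le> ?h * (e / 2)"
      using elim(3) d(2) by (intro mult_left_mono) auto
    ultimately show ?case
      by (simp add: algebra_simps)
  qed
qed

text \<open>For \<open>\<eta> = 0\<close> the hypothesis on \<open>w\<close> forces it to vanish
  along \<open>x\<close>. For \<open>\<eta> > 0\<close> it admits perturbations that are small
  relative to -\<mu>, and subtracting \<open>\<eta>\<close> from \<open>N (x t)\<close> absorbs them
  into a homogeneous inequality.\<close>

lemma solution_bound:
  fixes N :: "real ^ 'n \<Rightarrow> real" and A :: "real \<Rightarrow> real ^ 'n ^ 'n"
  assumes N: "vector_norm N" and A: "continuous_on {a..b} A" and "a \<le> b"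
    and x: "solution_on (\<lambda>x t. A t *v x + w x t) {a..b} x"
    and w: "\<And>t. t \<in> {a..b} \<Longrightarrow> N (w (x t) t) \<le> - \<eta> * logarithmic_norm N (A t)"
  shows "N (x b) - \<eta> \<le> exp (integral {a..b} (\<lambda>s. logarithmic_norm N (A s))) * (N (x a) - \<eta>)"
proof (rule dini_gronwall[OF \<open>a \<le> b\<close>])
  have "continuous_on {a..b} x"
    using x unfolding solution_on_def continuous_on_eq_continuous_within
    using has_vector_derivative_continuous by blast
  then show "continuous_on {a..b} (\<lambda>t. N (x t) - \<eta>)"
    by (intro continuous_intros continuous_on_compose2[OF continuous_on_vector_norm[OF N, of UNIV]])
      auto
  show "continuous_on {a..b} (\<lambda>s. logarithmic_norm N (A s))"
    by (intro continuous_on_compose2[OF continuous_on_logarithmic_norm[OF N, of UNIV]] A) auto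
next
  fix t e :: real
  assume t: "a \<le> t" "t < b" and e: "e > 0"
  have "(x has_vector_derivative A t *v x t + w (x t) t) (at t within {t..b})"
    using solution_on_subset[OF x, of "{t..b}"] t by (simp add: solution_on_def)
  from solution_dini[OF N t(2) e this] eventually_at_right_less[of t]
  show "\<forall>\<^sub>F s in at_right t. N (x s) - \<eta>
      \<le> N (x t) - \<eta> + (s - t) * (logarithmic_norm N (A t) * (N (x t) - \<eta>) + e)"
  proof eventually_elim
    case (elim s)
    have "(s - t) * N (w (x t) t) \<le> (s - t) * (- \<eta> * logarithmic_norm N (A t))"
      using elim(2) t by (intro mult_left_mono w) auto
    with elim(1) show ?case
      by (simp add: algebra_simps)
  qed
qed

section \<open>Integrals tending to minus infinity\<close>

lemma filterlim_integral_at_bot_shift: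
  fixes m :: "real \<Rightarrow> real"
  assumes m: "continuous_on {0..} m" and "a \<ge> 0"
    and lim: "filterlim (\<lambda>t. integral {0..t} m) at_bot at_top"
  shows "filterlim (\<lambda>t. integral {a..t} m) at_bot at_top"
proof -
  have eq: "integral {0..t} m - integral {0..a} m = integral {a..t} m" if "t \<ge> a" for t
  proof -
    have "m integrable_on {0..t}"
      using m by (intro integrable_continuous_interval) (auto intro: continuous_on_subset)
    then show ?thesis
      using Henstock_Kurzweil_Integration.integral_combine[of 0 a t m] that \<open>a \<ge> 0\<close> by simp
  qed
  have "filterlim (\<lambda>t. integral {0..t} m - integral {0..a} m) at_bot at_top"
    using lim filterlim_tendsto_add_at_bot_iff[OF tendsto_const, of "- integral {0..a} m"
        "\<lambda>t. integral {0..t} m" at_top] by simp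
  then show ?thesis
  proof (rule filterlim_cong[THEN iffD1, OF refl refl, rotated])
    show "\<forall>\<^sub>F t in at_top. integral {0..t} m - integral {0..a} m = integral {a..t} m"
      using eventually_ge_at_top[of a] by eventually_elim (rule eq)
  qed
qed

text \<open>The integral is eventually nonpositive, and on the remaining compact interval it is
  bounded by continuity. The bound depends on \<open>a\<close>, which is why the stability obtained
  from it need not be uniform.\<close>

lemma integral_bounded_above:
  fixes m :: "real \<Rightarrow> real"
  assumes m: "continuous_on {a..} m"
    and lim: "filterlim (\<lambda>t. integral {a..t} m) at_bot at_top"
  obtains B where "\<And>t. t \<ge> a \<Longrightarrow> integral {a..t} m \<le> B"
proof -
  have "\<forall>\<^sub>F t in at_top. integral {a..t} m \<le> 0"
    using lim by (simp add: filterlim_at_bot)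
  then obtain T where T: "\<And>t. t \<ge> T \<Longrightarrow> integral {a..t} m \<le> 0"
    by (auto simp: eventually_at_top_linorder)
  have "m integrable_on {a..T}"
    using m by (intro integrable_continuous_interval) (auto intro: continuous_on_subset)
  then have "compact ((\<lambda>t. integral {a..t} m) ` {a..T})"
    by (intro compact_continuous_image indefinite_integral_continuous_1) auto
  then have "bdd_above ((\<lambda>t. integral {a..t} m) ` {a..T})"
    by (intro bounded_imp_bdd_above compact_imp_bounded)
  then obtain B where "\<forall>t\<in>{a..T}. integral {a..t} m \<le> B"
    by (auto simp: bdd_above_def)
  then have "integral {a..t} m \<le> max B 0" if "t \<ge> a" for t
    using T[of t] that by (cases "t \<le> T") (force simp: le_max_iff_disj)+
  with that show ?thesis
    by blast
qed

lemma tendsto_0_of_vector_norm: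
  fixes x :: "real \<Rightarrow> 'a::euclidean_space"
  assumes N: "vector_norm N" and lim: "((\<lambda>t. N (x t)) \<longlongrightarrow> 0) F"
  shows "(x \<longlongrightarrow> 0) F"
proof -
  obtain c where c: "c > 0" "\<And>x. c * norm x \<le> N x"
    using norm_le_vector_norm[OF N] by blast
  have "norm (x t) \<le> N (x t) / c" for t
    using c by (simp add: field_simps)
  then show ?thesis
    using tendsto_divide[OF lim tendsto_const[of c]] c(1)
    by (intro Lim_null_comparison[of x "\<lambda>t. N (x t) / c"]) auto
qed

theorem theorem5:
  fixes A :: "real \<Rightarrow> real ^ 'n ^ 'n"
    and w :: "real ^ 'n \<Rightarrow> real \<Rightarrow> real ^ 'n"
    and N :: "real ^ 'n \<Rightarrow> real"
  assumes "continuous_on {0..} A"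
    and "continuous_on (UNIV \<times> {0..}) (\<lambda>(x, t). w x t)"
    and "vector_norm N"
    and "filterlim (\<lambda>t. integral {0..t} (\<lambda>s. logarithmic_norm N (A s))) at_bot at_top"
  shows "globally_asymptotically_stable_zero (\<lambda>x t. A t *v x) \<and>
    ((\<forall>\<^sub>F t in at_top. logarithmic_norm N (A t) < 0) \<and>
     (\<exists>wt :: real \<Rightarrow> real ^ 'n.
        (\<forall>x. \<forall>t\<ge>0. N (w x t) \<le> N (wt t)) \<and>
        ((\<lambda>t. N (wt t) / logarithmic_norm N (A t)) \<longlongrightarrow> 0) at_top)
     \<longrightarrow> (\<forall>x. solution_on (\<lambda>x t. A t *v x + w x t) {0..} x \<longrightarrow> (x \<longlongrightarrow> 0) at_top))"
proof -
  note N = \<open>vector_norm N\<close>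
  define m where "m t = logarithmic_norm N (A t)" for t
  have cont_A: "continuous_on {a..b} A" if "a \<ge> 0" for a b
    using assms(1) that by (auto intro: continuous_on_subset)
  have cont_m: "continuous_on {0..} m"
    unfolding m_def
    by (intro continuous_on_compose2[OF continuous_on_logarithmic_norm[OF N, of UNIV]] assms(1)) auto
  have lim: "filterlim (\<lambda>t. integral {a..t} m) at_bot at_top" if "a \<ge> 0" for a
    using filterlim_integral_at_bot_shift[OF cont_m that] assms(4) by (simp add: m_def[abs_def])
  have exp_lim: "((\<lambda>t. exp (integral {a..t} m) * K) \<longlongrightarrow> 0) at_top" if "a \<ge> 0" for a K
    using tendsto_mult[OF filterlim_compose[OF exp_at_bot lim[OF that]] tendsto_const[of K]] by simp
  have N0: "N 0 = 0"
    using vector_norm_eq_0_iff[OF N] by simp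
  have linear_bound: "N (x b) \<le> exp (integral {a..b} m) * N (x a)"
    if "solution_on (\<lambda>x t. A t *v x) {a..b} x" "0 \<le> a" "a \<le> b" for x a b
    using solution_bound[OF N cont_A \<open>a \<le> b\<close>, of "\<lambda>_ _. 0" x 0] that
    by (simp add: m_def[abs_def] N0)

  have "lyapunov_stable_zero (\<lambda>x t. A t *v x)"
    unfolding lyapunov_stable_zero_def
  proof (intro allI impI)
    fix a e :: real
    assume a: "a \<ge> 0" and e: "e > 0"
    have "continuous_on {a..} m"
      using cont_m a by (auto intro: continuous_on_subset)
    then obtain B where B: "\<And>t. t \<ge> a \<Longrightarrow> integral {a..t} m \<le> B"
      using integral_bounded_above lim[OF a] by blast
    obtain C where C: "C > 0" "\<And>x. N x \<le> C * norm x"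
      using vector_norm_le_norm[OF N] by blast
    obtain c where c: "c > 0" "\<And>x. c * norm x \<le> N x"
      using norm_le_vector_norm[OF N] by blast
    show "\<exists>d>0. \<forall>T\<ge>a. \<forall>x. solution_on (\<lambda>x t. A t *v x) {a..T} x \<longrightarrow> norm (x a) < d \<longrightarrow>
        (\<forall>t\<in>{a..T}. norm (x t) < e)"
    \<comment> \<open>The witness solves \<open>exp B * (C * d) = c * e\<close>: \<open>C\<close>
      and \<open>c\<close> convert between \<open>norm\<close> and \<open>N\<close>, and
      \<open>exp B\<close> bounds the growth of \<open>N\<close> along a solution started at time
      \<open>a\<close>.\<close>
    proof (intro exI[of _ "c * e / (exp B * C)"] conjI allI impI ballI)
      show "c * e / (exp B * C) > 0"
        using c(1) C(1) e by simp
    next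
      fix T x t
      assume x: "solution_on (\<lambda>x t. A t *v x) {a..T} x"
        and small: "norm (x a) < c * e / (exp B * C)" and t: "t \<in> {a..T}"
      have "c * norm (x t) \<le> N (x t)"
        by (rule c)
      also have "\<dots> \<le> exp (integral {a..t} m) * N (x a)"
        using t a by (intro linear_bound solution_on_subset[OF x]) auto
      also have "\<dots> \<le> exp B * (C * norm (x a))"
        using t by (intro mult_mono C) (auto simp: B vector_norm_nonneg[OF N])
      also have "\<dots> < c * e"
        using small C(1) by (simp add: field_simps)
      finally show "norm (x t) < e"
        using c(1) by simp
    qed
  qed
  moreover have "(x \<longlongrightarrow> 0) at_top" if a: "a \<ge> 0" and x: "solution_on (\<lambda>x t. A t *v x) {a..} x" for a x
  proof (rule tendsto_0_of_vector_norm[OF N], rule tendsto_sandwich[OF _ _ tendsto_const exp_lim[OF a]])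
    show "\<forall>\<^sub>F t in at_top. N (x t) \<le> exp (integral {a..t} m) * N (x a)"
      using eventually_ge_at_top[of a]
      by eventually_elim (use a in \<open>auto intro!: linear_bound solution_on_subset[OF x]\<close>)
  qed (simp add: vector_norm_nonneg[OF N])
  ultimately have "globally_asymptotically_stable_zero (\<lambda>x t. A t *v x)"
    by (auto simp: globally_asymptotically_stable_zero_def equilibrium_zero_def)
  moreover have "(x \<longlongrightarrow> 0) at_top"
    if neg: "\<forall>\<^sub>F t in at_top. m t < 0"
      and wt: "\<And>x t. t \<ge> 0 \<Longrightarrow> N (w x t) \<le> N (wt t)"
      and quot: "((\<lambda>t. N (wt t) / m t) \<longlongrightarrow> 0) at_top"
      and x: "solution_on (\<lambda>x t. A t *v x + w x t) {0..} x" for wt :: "real \<Rightarrow> real ^ 'n" and x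
  proof (rule tendsto_0_of_vector_norm[OF N], rule order_tendstoI)
    fix e :: real
    assume "e > 0"
    \<comment> \<open>Half of \<open>e\<close> is the offset in \<open>solution_bound\<close>, the
      other half is left for the decaying exponential term.\<close>
    define \<eta> where "\<eta> = e / 2"
    \<comment> \<open>Since \<open>m t\<close> is eventually negative, the quotient is nonpositive
      and its lower bound is the relevant one: multiplying by \<open>m t\<close> reverses it into
      the hypothesis of \<open>solution_bound\<close>.\<close>
    have "\<forall>\<^sub>F t in at_top. - \<eta> < N (wt t) / m t"
      using \<open>e > 0\<close> by (intro order_tendstoD(1)[OF quot]) (simp add: \<eta>_def)
    with neg eventually_ge_at_top[of 0] have "\<forall>\<^sub>F t in at_top. t \<ge> 0 \<and> N (wt t) \<le> - \<eta> * m t"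
      by eventually_elim (simp add: field_simps)
    then obtain a where a: "\<And>t. t \<ge> a \<Longrightarrow> t \<ge> 0 \<and> N (wt t) \<le> - \<eta> * m t"
      by (auto simp: eventually_at_top_linorder)
    then have "a \<ge> 0"
      by blast
    have "\<forall>\<^sub>F t in at_top. exp (integral {a..t} m) * (N (x a) - \<eta>) < \<eta>"
      using \<open>e > 0\<close> by (intro order_tendstoD(2)[OF exp_lim[OF \<open>a \<ge> 0\<close>]]) (simp add: \<eta>_def)
    with eventually_ge_at_top[of a] show "\<forall>\<^sub>F t in at_top. N (x t) < e"
    proof eventually_elim
      case (elim t)
      have "N (x t) - \<eta> \<le> exp (integral {a..t} m) * (N (x a) - \<eta>)"
        unfolding m_def
      proof (rule solution_bound[OF N cont_A[OF \<open>a \<ge> 0\<close>] elim(1)])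
        show "solution_on (\<lambda>x t. A t *v x + w x t) {a..t} x"
          using \<open>a \<ge> 0\<close> by (intro solution_on_subset[OF x]) auto
        show "N (w (x s) s) \<le> - \<eta> * logarithmic_norm N (A s)" if "s \<in> {a..t}" for s
          using a[of s] wt[of s "x s"] that by (auto simp: m_def)
      qed
      with elim(2) show ?case
        by (simp add: \<eta>_def)
    qed
  \<comment> \<open>The remaining half of the limit is immediate: any level below 0 lies below
    \<open>N (x t)\<close>.\<close>
  qed (auto intro!: always_eventually less_le_trans[OF _ vector_norm_nonneg[OF N]])
  ultimately show ?thesis
    unfolding m_def by blast
qed

end
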